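(* Let $d \geq 2$ be an integer, let $\mathbb{F}$ be a field, and let $V$ be a vector space over $\mathbb{F}$ of dimension $d+1$. Let $\Phi = (A; \{E_i\}_{i=0}^d; A^*; \{E^*_i\}_{i=0}^d)$ be a Hessenberg system on $V$. If $\Phi$ is TD, then $\Phi$ is recurrent (REC).
   Context: $\mathrm{End}(V)$ is the algebra of $\mathbb{F}$-linear maps $V\to V$. An element of $\mathrm{End}(V)$ is multiplicity-free if it is diagonalizable and every eigenspace has dimension one. For multiplicity-free $A$ with eigenspaces ordered $V_0,\dots,V_d$, the corresponding primitive idempotents are $E_0,\dots,E_d \in \mathrm{End}(V)$, where $E_i$ acts as the identity on $V_i$ and as $0$ on $V_j$ for $j\neq i$. The superscript $*$ in $A^*$, $E_i^*$, $\theta_i^*$ is just notation (not an adjoint). A Hessenberg system on $V$ is a sequence $\Phi=(A; \{E_i\}_{i=0}^d; A^*; \{E^*_i\}_{i=0}^d)$ of elements of $\mathrm{End}(V)$ such that: (i) $A$ and $A^*$ are multiplicity-free; (ii) $\{E_i\}_{i=0}^d$ is an ordering of the primitive idempotents of $A$; (iii) $\{E^*_i\}_{i=0}^d$ is an ordering of the primitive idempotents of $A^*$; (iv) for $0\le i,j\le d$, $E_iA^*E_j=0$ if $i-j>1$ and $E_iA^*E_j\neq 0$ if $i-j=1$; (v) for $0\le i,j\le d$, $E^*_iAE^*_j=0$ if $i-j>1$ and $E^*_iAE^*_j\neq 0$ if $i-j=1$. The eigenvalue sequence $\{\theta_i\}_{i=0}^d$ (resp. dual eigenvalue sequence $\{\theta^*_i\}_{i=0}^d$)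 of $\Phi$ is defined by letting $\theta_i$ (resp. $\theta^*_i$) be the eigenvalue of $A$ (resp. $A^*$) on $E_iV$ (resp. $E^*_iV$). A sequence $\{\sigma_i\}_{i=0}^n$ in $\mathbb{F}$ is $\beta$-recurrent ($\beta\in\mathbb{F}$) if $\sigma_{i-2}-(\beta+1)\sigma_{i-1}+(\beta+1)\sigma_i-\sigma_{i+1}=0$ for $2\le i\le n-1$ (a vacuous condition if $n=2$). $\Phi$ is recurrent (REC) if there exists $\beta\in\mathbb{F}$ such that each of $\{\theta_i\}_{i=0}^d$ and $\{\theta^*_i\}_{i=0}^d$ is $\beta$-recurrent. $\Phi$ is TD if there exist scalars $\beta,\gamma,\gamma^*,\varrho,\varrho^*\in\mathbb{F}$ such that $$0=[A, A^2A^*-\beta AA^*A+A^*A^2-\gamma(AA^*+A^*A)-\varrho A^*],$$ $$0=[A^*, A^{*2}A-\beta A^*AA^*+AA^{*2}-\gamma^*(A^*A+AA^* )-\varrho^*A],$$ where $[X,Y]=XY-YX$. *)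

theory Defs
  imports Main "HOL.Vector_Spaces"
begin

context vector_space
begin

definition End :: "('b \<Rightarrow> 'b) set" where
  "End = {X. Vector_Spaces.linear (*s) (*s) X}"

definition commutator :: "('b \<Rightarrow> 'b) \<Rightarrow> ('b \<Rightarrow> 'b) \<Rightarrow> 'b \<Rightarrow> 'b" where
  "commutator X Y = (\<lambda>v. X (Y v) - Y (X v))"

definition eigenspace :: "('b \<Rightarrow> 'b) \<Rightarrow> 'a \<Rightarrow> 'b set" where
  "eigenspace A t = {v. A v = t *s v}"

definition eigenvalue :: "('b \<Rightarrow> 'b) \<Rightarrow> 'a \<Rightarrow> bool" where
  "eigenvalue A t \<longleftrightarrow> (\<exists>v. v \<noteq> 0 \<and> A v = t *s v)"

definition eigenspaces :: "('b \<Rightarrow> 'b) \<Rightarrow> 'b set set" where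
  "eigenspaces A = {eigenspace A t | t. eigenvalue A t}"

definition diagonalizable :: "('b \<Rightarrow> 'b) \<Rightarrow> bool" where
  "diagonalizable A \<longleftrightarrow>
     (\<exists>B. independent B \<and> span B = UNIV \<and> (\<forall>b\<in>B. \<exists>t. A b = t *s b))"

definition multiplicity_free :: "('b \<Rightarrow> 'b) \<Rightarrow> bool" where
  "multiplicity_free A \<longleftrightarrow>
     A \<in> End \<and> diagonalizable A \<and> (\<forall>W\<in>eigenspaces A. dim W = 1)"

(* Sequences indexed by 0..d are functions on nat; values beyond d are never used. *)
definition primitive_idempotents :: "nat \<Rightarrow> ('b \<Rightarrow> 'b) \<Rightarrow> (nat \<Rightarrow> 'b \<Rightarrow> 'b) \<Rightarrow> bool" where
  "primitive_idempotents d A E \<longleftrightarrow>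
     (\<exists>W. bij_betw W {0..d} (eigenspaces A) \<and>
       (\<forall>i\<le>d. E i \<in> End \<and> (\<forall>j\<le>d. \<forall>v\<in>W j. E i v = (if i = j then v else 0))))"

definition hessenberg_system ::
  "nat \<Rightarrow> ('b \<Rightarrow> 'b) \<Rightarrow> (nat \<Rightarrow> 'b \<Rightarrow> 'b) \<Rightarrow> ('b \<Rightarrow> 'b) \<Rightarrow> (nat \<Rightarrow> 'b \<Rightarrow> 'b) \<Rightarrow> bool" where
  "hessenberg_system d A E As Es \<longleftrightarrow>
     multiplicity_free A \<and> multiplicity_free As \<and>
     primitive_idempotents d A E \<and>
     primitive_idempotents d As Es \<and>
     (\<forall>i\<le>d. \<forall>j\<le>d.
        (i > j + 1 \<longrightarrow> E i \<circ> As \<circ> E j = (\<lambda>_. 0)) \<and>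
        (i = j + 1 \<longrightarrow> E i \<circ> As \<circ> E j \<noteq> (\<lambda>_. 0))) \<and>
     (\<forall>i\<le>d. \<forall>j\<le>d.
        (i > j + 1 \<longrightarrow> Es i \<circ> A \<circ> Es j = (\<lambda>_. 0)) \<and>
        (i = j + 1 \<longrightarrow> Es i \<circ> A \<circ> Es j \<noteq> (\<lambda>_. 0)))"

(* For 0 <= i <= d the space E_i V is an eigenspace, hence nonzero, so the scalar is unique. *)
definition eigenvalue_sequence :: "('b \<Rightarrow> 'b) \<Rightarrow> (nat \<Rightarrow> 'b \<Rightarrow> 'b) \<Rightarrow> nat \<Rightarrow> 'a" where
  "eigenvalue_sequence A E i = (THE t. \<forall>v\<in>range (E i). A v = t *s v)"

definition tridiagonal_expr ::
  "'a \<Rightarrow> 'a \<Rightarrow> 'a \<Rightarrow> ('b \<Rightarrow> 'b) \<Rightarrow> ('b \<Rightarrow> 'b) \<Rightarrow> 'b \<Rightarrow> 'b" where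
  "tridiagonal_expr \<beta> \<gamma> \<rho> X Y = (\<lambda>v. X (X (Y v)) - \<beta> *s X (Y (X v)) + Y (X (X v))
     - \<gamma> *s (X (Y v) + Y (X v)) - \<rho> *s Y v)"

definition TD :: "('b \<Rightarrow> 'b) \<Rightarrow> ('b \<Rightarrow> 'b) \<Rightarrow> bool" where
  "TD A As \<longleftrightarrow> (\<exists>\<beta> \<gamma> \<gamma>s \<rho> \<rho>s.
     commutator A (tridiagonal_expr \<beta> \<gamma> \<rho> A As) = (\<lambda>_. 0) \<and>
     commutator As (tridiagonal_expr \<beta> \<gamma>s \<rho>s As A) = (\<lambda>_. 0))"

end

definition recurrent_seq :: "'a::field \<Rightarrow> nat \<Rightarrow> (nat \<Rightarrow> 'a) \<Rightarrow> bool" where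
  "recurrent_seq \<beta> n \<sigma> \<longleftrightarrow>
     (\<forall>i. 2 \<le> i \<and> i + 1 \<le> n \<longrightarrow>
        \<sigma> (i - 2) - (\<beta> + 1) * \<sigma> (i - 1) + (\<beta> + 1) * \<sigma> i - \<sigma> (i + 1) = 0)"

definition (in vector_space) REC ::
  "nat \<Rightarrow> ('b \<Rightarrow> 'b) \<Rightarrow> (nat \<Rightarrow> 'b \<Rightarrow> 'b) \<Rightarrow> ('b \<Rightarrow> 'b) \<Rightarrow> (nat \<Rightarrow> 'b \<Rightarrow> 'b) \<Rightarrow> bool" where
  "REC d A E As Es \<longleftrightarrow> (\<exists>\<beta>.
     recurrent_seq \<beta> d (eigenvalue_sequence A E) \<and>
     recurrent_seq \<beta> d (eigenvalue_sequence As Es))"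

end

(* Sandwiching the first TD relation between E i and E j multiplies E i A* E j by
   (\<theta> i - \<theta> j) p(\<theta> i, \<theta> j), where
   p(x, y) = x^2 - \<beta> x y + y^2 - \<gamma> (x + y) - \<rho>.  On the subdiagonal that product is nonzero,
   so p vanishes at consecutive eigenvalues.  Since p is symmetric,
   p(\<theta> (i + 1), \<theta> (i + 2)) - p(\<theta> (i + 1), \<theta> i) is divisible by \<theta> (i + 2) - \<theta> i, giving
   \<theta> i - \<beta> \<theta> (i + 1) + \<theta> (i + 2) = \<gamma>; differencing this once more eliminates \<gamma>.
   The second relation treats the dual eigenvalues in the same way, with the same \<beta>. *)
theory Submission imports Defs begin

context vector_space
begin

lemma End_add: "X \<in> End \<Longrightarrow> X (v + w) = X v + X w"
  and End_diff: "X \<in> End \<Longrightarrow> X (v - w) = X v - X w"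
  and End_scale: "X \<in> End \<Longrightarrow> X (c *s v) = c *s X v"
  and End_zero: "X \<in> End \<Longrightarrow> X 0 = 0"
  unfolding End_def Vector_Spaces.linear_iff_module_hom mem_Collect_eq
  by (simp_all add: module_hom.add module_hom.diff module_hom.scale module_hom.zero)

text \<open>Turns the description of \<open>E\<close> by eigenspaces into two-sided eigenvalue
  equations. Diagonalizability supplies a basis of eigenvectors, and identities between linear maps
  need checking only there.\<close>

lemma primitive_idempotents_eigenvalue_sequence:
  assumes A: "A \<in> End" and diag: "diagonalizable A" and prim: "primitive_idempotents d A E"
  shows "inj_on (eigenvalue_sequence A E) {0..d}"
    and "\<And>i. i \<le> d \<Longrightarrow> E i \<in> End"
    and "\<And>i v. i \<le> d \<Longrightarrow> A (E i v) = eigenvalue_sequence A E i *s E i v"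
    and "\<And>i v. i \<le> d \<Longrightarrow> E i (A v) = eigenvalue_sequence A E i *s E i v"
proof -
  from prim obtain W where bij: "bij_betw W {0..d} (eigenspaces A)"
    and E: "\<And>i. i \<le> d \<Longrightarrow> E i \<in> End"
    and EW: "\<And>i j v. i \<le> d \<Longrightarrow> j \<le> d \<Longrightarrow> v \<in> W j \<Longrightarrow> E i v = (if i = j then v else 0)"
    unfolding primitive_idempotents_def by blast
  have "\<exists>t. W i = eigenspace A t \<and> eigenvalue A t" if "i \<le> d" for i
    using bij_betw_apply[OF bij, of i] that by (auto simp: eigenspaces_def)
  then obtain \<theta> where W: "\<And>i. i \<le> d \<Longrightarrow> W i = eigenspace A (\<theta> i)"
    and ev: "\<And>i. i \<le> d \<Longrightarrow> eigenvalue A (\<theta> i)"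
    by metis
  from diag obtain B where B: "independent B" "span B = UNIV"
    and eigB: "\<And>b. b \<in> B \<Longrightarrow> \<exists>t. A b = t *s b"
    unfolding diagonalizable_def by blast
  \<comment> \<open>A basis vector is nonzero, so its eigenspace is genuine and is listed by the
    bijection \<open>W\<close>.\<close>
  have Wb: "\<exists>j\<le>d. b \<in> W j" if b: "b \<in> B" for b
  proof -
    obtain t where t: "A b = t *s b"
      using eigB[OF b] by blast
    have "b \<noteq> 0"
      using B(1) b dependent_zero by blast
    with t have "eigenspace A t \<in> eigenspaces A"
      unfolding eigenspaces_def eigenvalue_def by blast
    then obtain j where "j \<le> d" "W j = eigenspace A t"
      using bij by (metis atLeastAtMost_iff bij_betw_iff_bijections)
    with t show ?thesis
      by (auto simp: eigenspace_def)
  qed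
  have AE_EA: "A (E i v) = \<theta> i *s E i v \<and> E i (A v) = \<theta> i *s E i v" if i: "i \<le> d" for i v
  proof -
    note lin = End_add End_scale End_zero A E[OF i]
    have "v \<in> span B"
      using B by simp
    then show ?thesis
    proof (induction rule: span_induct)
      case base
      show ?case
        unfolding subspace_def
        by (simp add: lin scale_right_distrib scale_left_commute)
    next
      case (step b)
      then obtain j where j: "j \<le> d" "b \<in> W j"
        using Wb by blast
      with W have "A b = \<theta> j *s b"
        by (auto simp: eigenspace_def)
      \<comment> \<open>On \<open>b\<close> in \<open>W j\<close>, all three expressions equal
        \<open>\<theta> i *s b\<close> if \<open>i = j\<close> and \<open>0\<close>
        otherwise.\<close>
      with EW[OF i j] show ?case
        by (simp add: lin)
    qed
  qed
  have seq: "eigenvalue_sequence A E i = \<theta> i" if i: "i \<le> d" for i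
    unfolding eigenvalue_sequence_def
  proof (rule the_equality)
    show "\<forall>v\<in>range (E i). A v = \<theta> i *s v"
      using AE_EA[OF i] by blast
  next
    fix t assume t: "\<forall>v\<in>range (E i). A v = t *s v"
    obtain v where v: "v \<noteq> 0" "A v = \<theta> i *s v"
      using ev[OF i] unfolding eigenvalue_def by blast
    then have "v \<in> W i"
      by (simp add: W[OF i] eigenspace_def)
    \<comment> \<open>\<open>E i\<close> fixes \<open>W i\<close> pointwise, so its range contains a
      nonzero vector, which pins down the scalar.\<close>
    from EW[OF i i this] have "v \<in> range (E i)"
      by (metis rangeI)
    with t v show "t = \<theta> i"
      by (metis scale_cancel_right)
  qed
  show "inj_on (eigenvalue_sequence A E) {0..d}"
    \<comment> \<open>Equal eigenvalues would give equal eigenspaces, and \<open>W\<close> is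
      injective.\<close>
    using bij W seq unfolding bij_betw_def inj_on_def by simp
  show "\<And>i. i \<le> d \<Longrightarrow> E i \<in> End"
    by (rule E)
  show "\<And>i v. i \<le> d \<Longrightarrow> A (E i v) = eigenvalue_sequence A E i *s E i v"
    and "\<And>i v. i \<le> d \<Longrightarrow> E i (A v) = eigenvalue_sequence A E i *s E i v"
    using AE_EA seq by simp_all
qed

text \<open>Each \<open>X\<close> to the left of \<open>Y\<close> is absorbed by \<open>F\<close> as
  the scalar \<open>s\<close>, and each \<open>X\<close> to the right acts on \<open>w\<close> as
  \<open>t\<close>; the outer commutator contributes \<open>s - t\<close>.\<close>

lemma commutator_tridiagonal_eigenvector:
  assumes X: "X \<in> End" and Y: "Y \<in> End" and F: "F \<in> End"
    and FX: "\<And>v. F (X v) = s *s F v" and Xw: "X w = t *s w"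
  shows "F (commutator X (tridiagonal_expr \<beta> \<gamma> \<rho> X Y) w) =
    ((s - t) * (s\<^sup>2 - \<beta> * s * t + t\<^sup>2 - \<gamma> * (s + t) - \<rho>)) *s F (Y w)"
proof -
  note lin = End_add End_diff End_scale X Y F
  let ?P = "tridiagonal_expr \<beta> \<gamma> \<rho> X Y"
  have FP: "F (?P w) = (s\<^sup>2 - \<beta> * s * t + t\<^sup>2 - \<gamma> * (s + t) - \<rho>) *s F (Y w)"
    unfolding tridiagonal_expr_def
    by (simp add: lin FX Xw scale_left_diff_distrib scale_left_distrib scale_right_distrib
        scale_right_diff_distrib power2_eq_square algebra_simps)
  have "?P (t *s w) = t *s ?P w"
    unfolding tridiagonal_expr_def
    by (simp add: lin scale_right_distrib scale_right_diff_distrib mult.commute)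
  then have "F (commutator X ?P w) = s *s F (?P w) - t *s F (?P w)"
    unfolding commutator_def by (simp add: lin FX Xw)
  also have "\<dots> = (s - t) *s F (?P w)"
    by (simp add: scale_left_diff_distrib)
  finally show ?thesis
    by (simp add: FP)
qed

text \<open>Treats a single relation with \<open>\<beta>\<close> fixed in advance, so that
  exchanging the two maps yields the dual statement with the same \<open>\<beta>\<close>.\<close>

lemma recurrent_seq_eigenvalue_sequence:
  assumes A: "A \<in> End" and diag: "diagonalizable A" and prim: "primitive_idempotents d A E"
    and Y: "Y \<in> End"
    and sub: "\<And>j. j < d \<Longrightarrow> E (Suc j) \<circ> Y \<circ> E j \<noteq> (\<lambda>_. 0)"
    and comm: "commutator A (tridiagonal_expr \<beta> \<gamma> \<rho> A Y) = (\<lambda>_. 0)"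
  shows "recurrent_seq \<beta> d (eigenvalue_sequence A E)"
proof -
  define \<theta> where "\<theta> = eigenvalue_sequence A E"
  note pid = primitive_idempotents_eigenvalue_sequence[OF A diag prim, folded \<theta>_def]
  have neq: "\<theta> i \<noteq> \<theta> j" if "i \<le> d" "j \<le> d" "i \<noteq> j" for i j
    using inj_onD[OF pid(1), of i j] that by auto
  have p: "(\<theta> (Suc j))\<^sup>2 - \<beta> * \<theta> (Suc j) * \<theta> j + (\<theta> j)\<^sup>2 - \<gamma> * (\<theta> (Suc j) + \<theta> j) - \<rho> = 0"
    if j: "j < d" for j
  proof -
    from sub[OF j] obtain v where v: "E (Suc j) (Y (E j v)) \<noteq> 0"
      by (auto simp: fun_eq_iff)
    from j have le: "Suc j \<le> d" "j \<le> d"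
      by simp_all
    \<comment> \<open>\<open>E (Suc j)\<close> is applied to the vanishing commutator at
      \<open>E j v\<close>. The resulting scalar multiplies a nonzero vector, and its factor
      \<open>\<theta> (Suc j) - \<theta> j\<close> is nonzero.\<close>
    have "E (Suc j) 0 = 0"
      using pid(2)[OF le(1)] by (rule End_zero)
    with commutator_tridiagonal_eigenvector[OF A Y pid(2)[OF le(1)] pid(4)[OF le(1)] pid(3)[OF le(2)],
        of \<beta> \<gamma> \<rho> v] comm v neq[OF le]
    show ?thesis
      by simp
  qed
  have three: "\<theta> j - \<beta> * \<theta> (Suc j) + \<theta> (Suc (Suc j)) = \<gamma>" if j: "Suc j < d" for j
  proof -
    have "(\<theta> (Suc (Suc j)) - \<theta> j) * (\<theta> j - \<beta> * \<theta> (Suc j) + \<theta> (Suc (Suc j)) - \<gamma>) = 0"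
      using p[OF Suc_lessD[OF j]] p[OF j] by algebra
    with neq[of "Suc (Suc j)" j] j show ?thesis
      by simp
  qed
  show ?thesis
    unfolding recurrent_seq_def \<theta>_def[symmetric]
  proof (intro allI impI)
    fix i assume i: "2 \<le> i \<and> i + 1 \<le> d"
    then obtain k where k: "i = Suc (Suc k)"
      by (metis One_nat_def Suc_1 Suc_le_D Suc_le_mono)
    \<comment> \<open>The bound \<open>i + 1 \<le> d\<close> is exactly what the second instance
      requires, namely \<open>Suc (Suc k) < d\<close>.\<close>
    with i three[of k] three[of "Suc k"]
    have "\<theta> k - \<beta> * \<theta> (Suc k) + \<theta> (Suc (Suc k)) =
        \<theta> (Suc k) - \<beta> * \<theta> (Suc (Suc k)) + \<theta> (Suc (Suc (Suc k)))"
      by simp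
    then have "\<theta> k - (\<beta> + 1) * \<theta> (Suc k) + (\<beta> + 1) * \<theta> (Suc (Suc k)) - \<theta> (Suc (Suc (Suc k))) = 0"
      by algebra
    then show "\<theta> (i - 2) - (\<beta> + 1) * \<theta> (i - 1) + (\<beta> + 1) * \<theta> i - \<theta> (i + 1) = 0"
      by (simp add: k)
  qed
qed

end

theorem mainTheorem3:
  fixes scale :: "'f::field \<Rightarrow> 'v::ab_group_add \<Rightarrow> 'v"
    and d :: nat
    and A As :: "'v \<Rightarrow> 'v"
    and E Es :: "nat \<Rightarrow> 'v \<Rightarrow> 'v"
  assumes "vector_space scale"
    and "d \<ge> 2"
    and "vector_space.dim scale (UNIV :: 'v set) = d + 1"
    and "vector_space.hessenberg_system scale d A E As Es"
    and "vector_space.TD scale A As"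
  shows "vector_space.REC scale d A E As Es"
proof -
  interpret vector_space scale
    by fact
  from assms(5) obtain \<beta> \<gamma> \<gamma>s \<rho> \<rho>s where
    td: "commutator A (tridiagonal_expr \<beta> \<gamma> \<rho> A As) = (\<lambda>_. 0)"
      "commutator As (tridiagonal_expr \<beta> \<gamma>s \<rho>s As A) = (\<lambda>_. 0)"
    unfolding TD_def by blast
  note hess = assms(4)[unfolded hessenberg_system_def multiplicity_free_def]
  from hess have A: "A \<in> End" "diagonalizable A" "primitive_idempotents d A E"
    and As: "As \<in> End" "diagonalizable As" "primitive_idempotents d As Es"
    by simp_all
  have sub: "E (Suc j) \<circ> As \<circ> E j \<noteq> (\<lambda>_. 0)" "Es (Suc j) \<circ> A \<circ> Es j \<noteq> (\<lambda>_. 0)"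
    if "j < d" for j
    using hess that Suc_leI[OF that] less_imp_le[OF that] by (metis Suc_eq_plus1)+
  show ?thesis
    unfolding REC_def
    using recurrent_seq_eigenvalue_sequence[OF A As(1) sub(1) td(1)]
      recurrent_seq_eigenvalue_sequence[OF As A(1) sub(2) td(2)]
    by blast
qed

end
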